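(* For any $R > 0$ and any $\epsilon > 0$, there is a symplectic immersion from $B^4(R)$ into $B^2(1) \times \mathbb{R}^2$ such that each point in the range has at most two preimages and such that the set of points with two preimages has volume at most $\epsilon$.
   Context: $B^{2n}(R)$ denotes the open ball of radius $R$ in $\mathbb{R}^{2n}$ with the standard symplectic form $\sum_{i=1}^n dx_i \wedge dy_i$. $B^2(1) \times \mathbb{R}^2 \subset \mathbb{R}^4$ is the standard symplectic cylinder $\{x_1^2 + y_1^2 < 1\}$ with the restriction of the standard symplectic form. A symplectic immersion is a smooth immersion that pulls back the symplectic form of the target to the symplectic form of the source. "Range" refers to the target, and the set of points with two preimages is a subset of the target $B^2(1) \times \mathbb{R}^2$. *)

theory Defs
  imports "HOL-Analysis.Analysis"
begin

text \<open>
  The space R^(2n) is \<open>real^'n \<times> real^'n\<close> with \<open>n = CARD('n)\<close>; a point is the pair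
  \<open>(x, y)\<close> of its position coordinates \<open>x\<^sub>i\<close> and momentum coordinates \<open>y\<^sub>i\<close>.
  The norm of the product type is the Euclidean norm of R^(2n), so \<open>ball 0 R\<close> is
  the standard open ball, and the Lebesgue measure on this type is the standard volume.
\<close>

type_synonym 'n phase_space = "(real^'n) \<times> (real^'n)"

text \<open>The form \<open>\<Sum>i. dx\<^sub>i \<and> dy\<^sub>i\<close>, evaluated on a pair of tangent vectors.\<close>

definition std_symplectic_form :: "'n::finite phase_space \<Rightarrow> 'n phase_space \<Rightarrow> real" where
  "std_symplectic_form u v = (\<Sum>i\<in>UNIV. fst u $ i * snd v $ i - snd u $ i * fst v $ i)"

text \<open>
  Differentiability classes on an open set \<open>S\<close> (derivatives are taken with respect to
  the full neighbourhood filter): \<open>f\<close> is C^(k+1) iff it is differentiable at every point of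
  \<open>S\<close> and all its directional derivatives in fixed directions are C^k on \<open>S\<close>.
\<close>

fun Ck_on :: "nat \<Rightarrow> 'a::real_normed_vector set \<Rightarrow> ('a \<Rightarrow> 'b::real_normed_vector) \<Rightarrow> bool" where
  "Ck_on 0 S f \<longleftrightarrow> continuous_on S f"
| "Ck_on (Suc k) S f \<longleftrightarrow>
     (\<forall>x\<in>S. f differentiable (at x)) \<and>
     (\<forall>v. Ck_on k S (\<lambda>x. frechet_derivative f (at x) v))"

definition smooth_on :: "'a::real_normed_vector set \<Rightarrow> ('a \<Rightarrow> 'b::real_normed_vector) \<Rightarrow> bool" where
  "smooth_on S f \<longleftrightarrow> (\<forall>k. Ck_on k S f)"

definition smooth_immersion_on ::
    "'a::real_normed_vector set \<Rightarrow> ('a \<Rightarrow> 'b::real_normed_vector) \<Rightarrow> bool" where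
  "smooth_immersion_on S f \<longleftrightarrow>
     smooth_on S f \<and> (\<forall>x\<in>S. inj (frechet_derivative f (at x)))"

text \<open>
  Maps between open subsets \<open>S\<close> and \<open>T\<close> of standard symplectic spaces. The last clause
  says that the pullback of the form on \<open>T\<close> is the form on \<open>S\<close>.
\<close>

definition symplectic_immersion ::
    "'m::finite phase_space set \<Rightarrow> 'n::finite phase_space set \<Rightarrow>
     ('m phase_space \<Rightarrow> 'n phase_space) \<Rightarrow> bool" where
  "symplectic_immersion S T f \<longleftrightarrow>
     f ` S \<subseteq> T \<and> smooth_immersion_on S f \<and>
     (\<forall>x\<in>S. \<forall>u v. std_symplectic_form (frechet_derivative f (at x) u)
                                      (frechet_derivative f (at x) v)
                 = std_symplectic_form u v)"

definition symplectic_cylinder :: "2 phase_space set" where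
  "symplectic_cylinder = {z. (fst z $ 1)\<^sup>2 + (snd z $ 1)\<^sup>2 < 1}"

end

theory Submission
  imports Defs
begin

text \<open>
  After the linear map \<open>(x\<^sub>1, y\<^sub>1) \<mapsto> (a x\<^sub>1, y\<^sub>1 / a)\<close> with \<open>a\<close> large, the first factor of the ball lies in
  a long thin strip, which an area-preserving map winds many times around a thin ribbon about a
  circle of radius 1/2 that is centred at distance 1/4 from the origin. Each turn of the ribbon
  crosses the thin annulus \<open>\<bar>|z|\<^sup>2 - 5/16\<bar> \<le> 2R/a\<close> twice, once outwards and once inwards. During the
  outward crossing we apply the Hamiltonian flow of \<open>x\<^sub>2 G(|z|\<^sup>2)\<close>, where \<open>G\<close> is a smooth step
  from 0 to \<open>2R\<close> across the annulus: it rotates \<open>z\<close>, spreading the ribbon over the annulus, and raises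
  \<open>y\<^sub>2\<close> by \<open>2R\<close> per turn, which makes the turns disjoint. The resulting map is injective on
  the outward and on the inward halves separately, so it is at most two-to-one. Double points
  lie over the inward crossing, whose area is \<open>O(1/a\<^sup>2)\<close>, while \<open>y\<^sub>2\<close> ranges over an
  interval of length \<open>O(a)\<close>, so their volume is \<open>O(1/a)\<close>.
\<close>

section \<open>Calculus of smooth maps\<close>

text \<open>Openness of \<open>S\<close> makes agreement on \<open>S\<close> hold on a full
  neighbourhood of each point, which is what \<open>frechet_derivative\<close> sees.\<close>

lemma Ck_on_cong:
  fixes f g :: "'a::real_normed_vector \<Rightarrow> 'b::real_normed_vector"
  assumes "open S" "\<And>x. x \<in> S \<Longrightarrow> f x = g x" "Ck_on k S f"
  shows "Ck_on k S g"
  using assms(2,3)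
proof (induction k arbitrary: f g)
  case 0
  then show ?case
    by (simp cong: continuous_on_cong)
next
  case (Suc k)
  have D: "(g has_derivative frechet_derivative f (at x)) (at x)" if "x \<in> S" for x
  proof (rule has_derivative_transform_within_open[OF _ assms(1) that])
    show "(f has_derivative frechet_derivative f (at x)) (at x)"
      using Suc.prems(2) that by (simp add: frechet_derivative_works)
  qed (rule Suc.prems(1))
  have "Ck_on k S (\<lambda>x. frechet_derivative g (at x) v)" for v
  proof (rule Suc.IH)
    show "Ck_on k S (\<lambda>x. frechet_derivative f (at x) v)"
      using Suc.prems(2) by simp
    show "frechet_derivative f (at x) v = frechet_derivative g (at x) v" if "x \<in> S" for x
      using frechet_derivative_at[OF D[OF that]] by simp
  qed
  then show ?case
    using D by (auto simp: differentiable_def)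
qed

text \<open>Working rule for the inductions below: by uniqueness of derivatives, any explicit
  derivative \<open>D\<close> may stand in for \<open>frechet_derivative\<close>.\<close>

lemma Ck_on_SucI:
  fixes f :: "'a::real_normed_vector \<Rightarrow> 'b::real_normed_vector"
  assumes "open S" "\<And>x. x \<in> S \<Longrightarrow> (f has_derivative D x) (at x)" "\<And>v. Ck_on k S (\<lambda>x. D x v)"
  shows "Ck_on (Suc k) S f"
proof -
  have "Ck_on k S (\<lambda>x. frechet_derivative f (at x) v)" for v
  proof (rule Ck_on_cong[OF assms(1) _ assms(3)])
    show "D x v = frechet_derivative f (at x) v" if "x \<in> S" for x
      using frechet_derivative_at[OF assms(2)[OF that]] by simp
  qed
  then show ?thesis
    using assms(2) by (auto simp: differentiable_def)
qed

lemma Ck_on_SucE: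
  assumes "Ck_on (Suc k) S f" "x \<in> S"
  shows "(f has_derivative frechet_derivative f (at x)) (at x)"
  using assms by (simp add: frechet_derivative_works)

lemma Ck_on_Suc_lower: "Ck_on (Suc k) S f \<Longrightarrow> Ck_on k S f"
proof (induction k arbitrary: f)
  case 0
  then show ?case
    by (simp add: continuous_at_imp_continuous_on differentiable_imp_continuous_within)
next
  case (Suc k)
  have "Ck_on k S (\<lambda>x. frechet_derivative f (at x) v)" for v
    using Suc.prems unfolding Ck_on.simps(2)[of "Suc k"] by (intro Suc.IH) blast
  then show ?case using Suc.prems by simp
qed

text \<open>Allows smoothness to be checked on charts; the final map has a single formula only
  locally.\<close>

lemma Ck_on_local:
  assumes "\<And>x. x \<in> S \<Longrightarrow> \<exists>U. open U \<and> x \<in> U \<and> Ck_on k U f"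
  shows "Ck_on k S f"
  using assms
proof (induction k arbitrary: f)
  case 0
  show ?case
    unfolding Ck_on.simps
  proof (rule continuous_at_imp_continuous_on, rule ballI)
    fix x assume "x \<in> S"
    then obtain U where "open U" "x \<in> U" "continuous_on U f"
      using 0[of x] by auto
    then show "isCont f x" using continuous_on_eq_continuous_at by blast
  qed
next
  case (Suc k)
  have "Ck_on k S (\<lambda>x. frechet_derivative f (at x) v)" for v
  proof (rule Suc.IH)
    fix x assume "x \<in> S"
    then obtain U where "open U" "x \<in> U" "Ck_on (Suc k) U f"
      using Suc.prems[of x] by blast
    then show "\<exists>U. open U \<and> x \<in> U \<and> Ck_on k U (\<lambda>x. frechet_derivative f (at x) v)"
      by (intro exI[of _ U]) simp
  qed
  moreover have "f differentiable at x" if "x \<in> S" for x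
  proof -
    obtain U where "x \<in> U" "Ck_on (Suc k) U f"
      using Suc.prems[of x] \<open>x \<in> S\<close> by blast
    then show ?thesis by simp
  qed
  ultimately show ?case by simp
qed

lemma smooth_on_local:
  assumes "\<And>x. x \<in> S \<Longrightarrow> \<exists>U. open U \<and> x \<in> U \<and> smooth_on U f"
  shows "smooth_on S f"
  unfolding smooth_on_def
proof (intro allI Ck_on_local)
  fix k x assume "x \<in> S"
  then obtain U where "open U" "x \<in> U" "smooth_on U f"
    using assms[of x] by blast
  then show "\<exists>U. open U \<and> x \<in> U \<and> Ck_on k U f"
    by (intro exI[of _ U]) (simp add: smooth_on_def)
qed

lemma smooth_on_cong:
  fixes f g :: "'a::real_normed_vector \<Rightarrow> 'b::real_normed_vector"
  assumes "open S" "\<And>x. x \<in> S \<Longrightarrow> f x = g x" "smooth_on S f"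
  shows "smooth_on S g"
  unfolding smooth_on_def
proof
  show "Ck_on k S g" for k
  proof (rule Ck_on_cong[OF assms(1)])
    show "f x = g x" if "x \<in> S" for x using assms(2) that .
    show "Ck_on k S f" using assms(3) by (simp only: smooth_on_def)
  qed
qed

section \<open>Linear maps, sums and products\<close>

lemma Ck_on_const: "Ck_on k S (\<lambda>x. c)"
proof (induction k arbitrary: c)
  case (Suc k)
  then show ?case by (simp add: frechet_derivative_const)
qed simp

lemma smooth_on_const: "smooth_on S (\<lambda>x. c)"
  by (simp add: smooth_on_def Ck_on_const)

lemma smooth_on_bounded_linear:
  assumes "bounded_linear f"
  shows "smooth_on S f"
proof -
  have "frechet_derivative f (at x) = f" for x
    using assms bounded_linear_imp_has_derivative frechet_derivative_at by metis
  then have "Ck_on k S f" for k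
    using assms
    by (cases k) (auto simp: Ck_on_const linear_continuous_on bounded_linear_imp_differentiable)
  then show ?thesis by (simp add: smooth_on_def)
qed

lemma Ck_on_add:
  assumes "open S" "Ck_on k S f" "Ck_on k S g"
  shows "Ck_on k S (\<lambda>x. f x + g x)"
  using assms(2,3)
proof (induction k arbitrary: f g)
  case 0
  then show ?case by (simp add: continuous_on_add)
next
  case (Suc k)
  show ?case
  proof (rule Ck_on_SucI[OF assms(1)])
    show "((\<lambda>x. f x + g x) has_derivative
        (\<lambda>v. frechet_derivative f (at x) v + frechet_derivative g (at x) v)) (at x)"
      if "x \<in> S" for x
      using Suc.prems that by (intro has_derivative_add Ck_on_SucE)
    show "Ck_on k S (\<lambda>x. frechet_derivative f (at x) v + frechet_derivative g (at x) v)" for v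
      using Suc by auto
  qed
qed

lemma smooth_on_add:
  assumes "open S" "smooth_on S f" "smooth_on S g"
  shows "smooth_on S (\<lambda>x. f x + g x)"
  unfolding smooth_on_def
  by (intro allI Ck_on_add assms(1)) (use assms(2,3) in \<open>simp_all only: smooth_on_def\<close>)

lemma Ck_on_scaleR:
  fixes f :: "'a::real_normed_vector \<Rightarrow> real" and g :: "'a \<Rightarrow> 'b::real_normed_vector"
  assumes "open S" "Ck_on k S f" "Ck_on k S g"
  shows "Ck_on k S (\<lambda>x. f x *\<^sub>R g x)"
  using assms(2,3)
proof (induction k arbitrary: f g)
  case 0
  then show ?case by (simp add: continuous_on_scaleR)
next
  case (Suc k)
  show ?case
  proof (rule Ck_on_SucI[OF assms(1)])
    show "((\<lambda>x. f x *\<^sub>R g x) has_derivative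
        (\<lambda>v. f x *\<^sub>R frechet_derivative g (at x) v + frechet_derivative f (at x) v *\<^sub>R g x)) (at x)"
      if "x \<in> S" for x
      using Suc.prems that by (intro has_derivative_scaleR Ck_on_SucE)
    \<comment> \<open>The product rule brings back \<open>f\<close> and \<open>g\<close> themselves,
      so they are lowered from C^(k+1) to C^k before the induction hypothesis applies.\<close>
    show "Ck_on k S (\<lambda>x. f x *\<^sub>R frechet_derivative g (at x) v + frechet_derivative f (at x) v *\<^sub>R g x)"
      for v
      using Suc.prems
      by (intro Ck_on_add[OF assms(1)] Suc.IH Ck_on_Suc_lower[OF Suc.prems(1)]
          Ck_on_Suc_lower[OF Suc.prems(2)]) auto
  qed
qed

lemma smooth_on_scaleR:
  fixes f :: "'a::real_normed_vector \<Rightarrow> real"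
  assumes "open S" "smooth_on S f" "smooth_on S g"
  shows "smooth_on S (\<lambda>x. f x *\<^sub>R g x)"
  unfolding smooth_on_def
  by (intro allI Ck_on_scaleR assms(1)) (use assms(2,3) in \<open>simp_all only: smooth_on_def\<close>)

lemma smooth_on_mult:
  fixes f g :: "'a::real_normed_vector \<Rightarrow> real"
  assumes "open S" "smooth_on S f" "smooth_on S g"
  shows "smooth_on S (\<lambda>x. f x * g x)"
  using smooth_on_scaleR[OF assms] by (simp only: real_scaleR_def)

lemma smooth_on_diff:
  fixes f g :: "'a::real_normed_vector \<Rightarrow> 'b::real_normed_vector"
  assumes "open S" "smooth_on S f" "smooth_on S g"
  shows "smooth_on S (\<lambda>x. f x - g x)"
proof -
  have "smooth_on S (\<lambda>x. (-1) *\<^sub>R g x)"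
    by (rule smooth_on_scaleR[OF assms(1) smooth_on_const assms(3)])
  from smooth_on_add[OF assms(1,2) this] show ?thesis by simp
qed

lemma smooth_on_power:
  fixes f :: "'a::real_normed_vector \<Rightarrow> real"
  assumes "open S" "smooth_on S f"
  shows "smooth_on S (\<lambda>x. f x ^ n)"
proof (induction n)
  case 0
  then show ?case by (simp add: smooth_on_const)
next
  case (Suc n)
  from smooth_on_mult[OF assms this] show ?case by simp
qed

section \<open>Functions of one real variable and composition with them\<close>

lemma Ck_on_SucI_real:
  fixes f :: "real \<Rightarrow> real"
  assumes "open S" "\<And>x. x \<in> S \<Longrightarrow> (f has_real_derivative f' x) (at x)" "Ck_on k S f'"
  shows "Ck_on (Suc k) S f"
proof (rule Ck_on_SucI[OF assms(1)])
  show "(f has_derivative (\<lambda>v. f' x * v)) (at x)" if "x \<in> S" for x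
    using assms(2)[OF that] by (simp add: has_field_derivative_def)
  show "Ck_on k S (\<lambda>x. f' x * v)" for v
    using Ck_on_scaleR[OF assms(1,3) Ck_on_const[of k S v]] by simp
qed

lemma Ck_on_SucE_real:
  fixes f :: "real \<Rightarrow> real"
  assumes "open S" "Ck_on (Suc k) S f"
  shows "x \<in> S \<Longrightarrow> (f has_real_derivative deriv f x) (at x)" "Ck_on k S (deriv f)"
proof -
  show D: "(f has_real_derivative deriv f x) (at x)" if "x \<in> S" for x
    using assms(2) that by (simp add: DERIV_deriv_iff_real_differentiable)
  show "Ck_on k S (deriv f)"
  proof (rule Ck_on_cong[OF assms(1)])
    show "Ck_on k S (\<lambda>x. frechet_derivative f (at x) 1)"
      using assms(2) by simp
    show "frechet_derivative f (at x) 1 = deriv f x" if "x \<in> S" for x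
      using frechet_derivative_at[OF D[OF that, unfolded has_field_derivative_def]]
      by (metis mult.right_neutral)
  qed
qed

lemma smooth_on_deriv:
  fixes f :: "real \<Rightarrow> real"
  assumes "open S" "smooth_on S f"
  shows "x \<in> S \<Longrightarrow> (f has_real_derivative deriv f x) (at x)" "smooth_on S (deriv f)"
proof -
  have *: "Ck_on (Suc k) S f" for k
    using assms(2) unfolding smooth_on_def by blast
  show "x \<in> S \<Longrightarrow> (f has_real_derivative deriv f x) (at x)"
    by (rule Ck_on_SucE_real(1)[OF assms(1) *])
  show "smooth_on S (deriv f)"
    unfolding smooth_on_def by (intro allI Ck_on_SucE_real(2)[OF assms(1) *])
qed

text \<open>The induction generalises the outer function only: the chain rule turns \<open>h\<close>
  into \<open>deriv h\<close> but keeps \<open>f\<close> inside, and the product rule handles the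
  remaining factor.\<close>

lemma Ck_on_compose_real:
  fixes f :: "'a::real_normed_vector \<Rightarrow> real" and h :: "real \<Rightarrow> real"
  assumes "open S" "open T" "\<And>x. x \<in> S \<Longrightarrow> f x \<in> T" "Ck_on k T h" "Ck_on k S f"
  shows "Ck_on k S (\<lambda>x. h (f x))"
  using assms(4,5)
proof (induction k arbitrary: h)
  case 0
  have "f ` S \<subseteq> T" using assms(3) by blast
  then show ?case using 0 continuous_on_compose2 by (metis Ck_on.simps(1))
next
  case (Suc k)
  show ?case
  proof (rule Ck_on_SucI[OF assms(1)])
    show "((\<lambda>x. h (f x)) has_derivative (\<lambda>v. deriv h (f x) *\<^sub>R frechet_derivative f (at x) v)) (at x)"
      if "x \<in> S" for x
      using DERIV_compose_FDERIV[OF Ck_on_SucE_real(1)[OF assms(2) Suc.prems(1) assms(3)[OF that]]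
          Ck_on_SucE[OF Suc.prems(2) that]]
      by (simp add: mult.commute)
    show "Ck_on k S (\<lambda>x. deriv h (f x) *\<^sub>R frechet_derivative f (at x) v)" for v
    proof (rule Ck_on_scaleR[OF assms(1)])
      show "Ck_on k S (\<lambda>x. deriv h (f x))"
        by (rule Suc.IH[OF Ck_on_SucE_real(2)[OF assms(2) Suc.prems(1)]
              Ck_on_Suc_lower[OF Suc.prems(2)]])
      show "Ck_on k S (\<lambda>x. frechet_derivative f (at x) v)"
        using Suc.prems(2) by simp
    qed
  qed
qed

lemma smooth_on_compose_real:
  fixes f :: "'a::real_normed_vector \<Rightarrow> real" and h :: "real \<Rightarrow> real"
  assumes "open S" "open T" "smooth_on T h" "smooth_on S f" "\<And>x. x \<in> S \<Longrightarrow> f x \<in> T"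
  shows "smooth_on S (\<lambda>x. h (f x))"
  unfolding smooth_on_def
proof
  show "Ck_on k S (\<lambda>x. h (f x))" for k
    by (rule Ck_on_compose_real[OF assms(1,2,5)])
      (use assms(3,4) in \<open>simp_all only: smooth_on_def\<close>)
qed

lemma smooth_on_sin_cos: "smooth_on UNIV (sin :: real \<Rightarrow> real)" "smooth_on UNIV (cos :: real \<Rightarrow> real)"
proof -
  \<comment> \<open>One joint induction, since each function is up to sign the derivative of the
    other.\<close>
  have "Ck_on k UNIV (sin :: real \<Rightarrow> real) \<and> Ck_on k UNIV (cos :: real \<Rightarrow> real)" for k
  proof (induction k)
    case 0
    then show ?case by (simp add: continuous_on_sin continuous_on_cos)
  next
    case (Suc k)
    have "Ck_on k UNIV (\<lambda>x::real. (-1) *\<^sub>R sin x)"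
      using Suc by (intro Ck_on_scaleR Ck_on_const) auto
    then show ?case
      using Suc
      by (auto simp del: Ck_on.simps intro!: Ck_on_SucI_real[OF open_UNIV] DERIV_sin DERIV_cos)
  qed
  then show "smooth_on UNIV (sin :: real \<Rightarrow> real)" "smooth_on UNIV (cos :: real \<Rightarrow> real)"
    by (auto simp: smooth_on_def)
qed

text \<open>The derivative is a polynomial in the function itself, so the induction hypothesis
  already covers it; \<open>sqrt\<close> below works alike.\<close>

lemma smooth_on_inverse: "smooth_on (- {0}) (inverse :: real \<Rightarrow> real)"
proof -
  have op: "open (- {0::real})" by (rule open_Compl) simp
  have "Ck_on k (- {0}) (inverse :: real \<Rightarrow> real)" for k
  proof (induction k)
    case 0
    then show ?case by (auto intro!: continuous_intros)
  next
    case (Suc k)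
    have "Ck_on k (- {0}) (\<lambda>x::real. (-1) *\<^sub>R (inverse x *\<^sub>R inverse x))"
      by (rule Ck_on_scaleR[OF op Ck_on_const Ck_on_scaleR[OF op Suc Suc]])
    moreover have "(inverse has_real_derivative (-1) *\<^sub>R (inverse x *\<^sub>R inverse x)) (at x)"
      if "x \<in> - {0}" for x :: real
      using that by (auto intro!: derivative_eq_intros)
    ultimately show ?case by (rule Ck_on_SucI_real[OF op, rotated])
  qed
  then show ?thesis by (simp add: smooth_on_def)
qed

lemma smooth_on_sqrt: "smooth_on {0<..} sqrt"
proof -
  have op: "open {0::real<..}" by simp
  have "Ck_on k {0<..} sqrt" for k
  proof (induction k)
    case 0
    then show ?case by (auto intro!: continuous_intros)
  next
    case (Suc k)
    have "Ck_on k {0<..} (\<lambda>x. inverse (sqrt x) *\<^sub>R (1/2))"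
      using smooth_on_inverse
      by (intro Ck_on_scaleR Ck_on_const op Ck_on_compose_real[of _ "- {0}" sqrt k inverse] Suc)
        (auto simp: smooth_on_def)
    moreover have "(sqrt has_real_derivative inverse (sqrt x) *\<^sub>R (1/2)) (at x)"
      if "x \<in> {0<..}" for x :: real
      using that DERIV_real_sqrt[of x] by (simp add: mult.commute)
    ultimately show ?case by (rule Ck_on_SucI_real[OF op, rotated])
  qed
  then show ?thesis by (simp add: smooth_on_def)
qed

section \<open>A smooth step built from exp(-1/x)\<close>

text \<open>The extra powers of \<open>1 / x\<close> close the family under differentiation, so one
  induction over all \<open>n\<close> gives smoothness of exp(-1/x) extended by 0.\<close>

definition flat :: "nat \<Rightarrow> real \<Rightarrow> real" where
  "flat n x = (if x > 0 then (1 / x) ^ n * exp (- (1 / x)) else 0)"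

lemma flat_tendsto_0: "(flat n \<longlongrightarrow> 0) (at 0)"
proof -
  have "((\<lambda>x::real. (1 / x) ^ n / exp (1 / x)) \<longlongrightarrow> 0) (at_right 0)"
    using filterlim_compose[OF tendsto_power_div_exp_0 filterlim_inverse_at_top_right]
    by (simp add: inverse_eq_divide)
  then have "(flat n \<longlongrightarrow> 0) (at_right 0)"
    by (rule Lim_transform_eventually)
      (auto simp: flat_def eventually_at_filter exp_minus divide_inverse)
  moreover have "(flat n \<longlongrightarrow> 0) (at_left 0)"
    by (rule Lim_transform_eventually[OF tendsto_const])
      (auto simp: flat_def eventually_at_filter)
  ultimately show ?thesis
    by (simp add: filterlim_at_split)
qed

lemma flat_derivative:
  "(flat n has_real_derivative flat (n + 2) x - n * flat (n + 1) x) (at x)"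
proof (cases x "0 :: real" rule: linorder_cases)
  case less
  have "((\<lambda>x. 0) has_real_derivative 0) (at x)" by simp
  then have "(flat n has_real_derivative 0) (at x)"
    by (rule has_field_derivative_transform_within_open[of _ _ _ "{..<0}"])
      (use less in \<open>auto simp: flat_def\<close>)
  with less show ?thesis by (simp add: flat_def)
next
  case equal
  \<comment> \<open>Since \<open>flat n 0 = 0\<close>, the difference quotient at 0 is
    \<open>flat (Suc n)\<close>, whose limit is known.\<close>
  have "((\<lambda>h. (flat n h - flat n 0) / h) \<longlongrightarrow> 0) (at 0)"
    by (rule Lim_transform_eventually[OF flat_tendsto_0[of "Suc n"]])
      (auto simp: flat_def eventually_at_filter)
  with equal show ?thesis by (simp add: has_field_derivative_iff flat_def)
next
  case greater
  have inv: "((\<lambda>x. 1 / x) has_real_derivative - ((1 / x)\<^sup>2)) (at x)"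
    using greater by (auto intro!: derivative_eq_intros simp: power2_eq_square)
  have "real n * ((1 / x)\<^sup>2 * (1 / x) ^ (n - Suc 0)) = real n * (1 / x) ^ (n + 1)"
    by (cases n) (simp_all add: power2_eq_square)
  with DERIV_power[OF inv, of n]
  have pow: "((\<lambda>x. (1 / x) ^ n) has_real_derivative - (real n * (1 / x) ^ (n + 1))) (at x)"
    by simp
  have "((\<lambda>x. exp (- (1 / x))) has_real_derivative exp (- (1 / x)) * (1 / x)\<^sup>2) (at x)"
    using DERIV_fun_exp[OF DERIV_minus[OF inv]] by simp
  from DERIV_mult[OF pow this]
  have "((\<lambda>x. (1 / x) ^ n * exp (- (1 / x))) has_real_derivative
      flat (n + 2) x - n * flat (n + 1) x) (at x)"
    using greater by (simp add: flat_def power_add power2_eq_square algebra_simps)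
  then show ?thesis
    by (rule has_field_derivative_transform_within_open[of _ _ _ "{0<..}"])
      (use greater in \<open>auto simp: flat_def\<close>)
qed

lemma smooth_on_flat: "smooth_on UNIV (flat n)"
proof -
  have "Ck_on k UNIV (flat n)" for k
  proof (induction k arbitrary: n)
    case 0
    have "isCont (flat n) x" for x
      by (rule DERIV_isCont[OF flat_derivative])
    then show ?case by (simp add: continuous_at_imp_continuous_on)
  next
    case (Suc k)
    have "Ck_on k UNIV (\<lambda>x. flat (n + 2) x + (- real n) *\<^sub>R flat (n + 1) x)"
      by (rule Ck_on_add[OF open_UNIV Suc Ck_on_scaleR[OF open_UNIV Ck_on_const Suc]])
    then show ?case
    proof (rule Ck_on_SucI_real[OF open_UNIV, rotated])
      show "(flat n has_real_derivative flat (n + 2) x + (- real n) *\<^sub>R flat (n + 1) x) (at x)" for x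
        using flat_derivative[of n x] by simp
    qed
  qed
  then show ?thesis by (simp add: smooth_on_def)
qed

lemma smooth_step:
  fixes a b c :: real
  assumes "a < b"
  obtains G where "smooth_on UNIV G" "\<And>x. x \<le> a \<Longrightarrow> G x = 0" "\<And>x. x \<ge> b \<Longrightarrow> G x = c"
proof -
  \<comment> \<open>The step is c u / (u + v). As \<open>a < b\<close>, at least one of u and v is
    positive at every point; u vanishes up to \<open>a\<close> and v from \<open>b\<close>
    on.\<close>
  define u v where "u x = flat 0 (x - a)" and "v x = flat 0 (b - x)" for x
  have pos: "u x + v x > 0" for x
    using assms by (auto simp: u_def v_def flat_def add_nonneg_pos add_pos_nonneg)
  have id: "smooth_on UNIV (\<lambda>x::real. x)"
    by (rule smooth_on_bounded_linear) (rule bounded_linear_ident)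
  have s: "smooth_on UNIV u" "smooth_on UNIV v"
    unfolding u_def v_def
    using smooth_on_diff[OF open_UNIV id smooth_on_const]
      smooth_on_diff[OF open_UNIV smooth_on_const id]
    by (auto intro: smooth_on_compose_real[OF open_UNIV open_UNIV smooth_on_flat])
  have "smooth_on UNIV (\<lambda>x. inverse (u x + v x))"
  proof (rule smooth_on_compose_real[OF open_UNIV _ smooth_on_inverse])
    show "smooth_on UNIV (\<lambda>x. u x + v x)"
      by (rule smooth_on_add[OF open_UNIV s])
    show "u x + v x \<in> - {0}" for x using pos[of x] by simp
  qed (rule open_Compl, simp)
  then have "smooth_on UNIV (\<lambda>x. c * (u x * inverse (u x + v x)))"
    by (rule smooth_on_mult[OF open_UNIV smooth_on_const smooth_on_mult[OF open_UNIV s(1)]])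
  then show thesis
  proof (rule that)
    show "c * (u x * inverse (u x + v x)) = 0" if "x \<le> a" for x
      using that by (simp add: u_def flat_def)
    show "c * (u x * inverse (u x + v x)) = c" if "x \<ge> b" for x
      using that pos[of x] by (simp add: v_def flat_def)
  qed
qed

section \<open>Symplectic maps of four-space\<close>

abbreviation x1 :: "2 phase_space \<Rightarrow> real" where "x1 p \<equiv> fst p $ 1"
abbreviation y1 :: "2 phase_space \<Rightarrow> real" where "y1 p \<equiv> snd p $ 1"
abbreviation x2 :: "2 phase_space \<Rightarrow> real" where "x2 p \<equiv> fst p $ 2"
abbreviation y2 :: "2 phase_space \<Rightarrow> real" where "y2 p \<equiv> snd p $ 2"

text \<open>A combination of fixed basis vectors, so that the rules for sums and scalar multiples
  apply directly to maps given by coordinates.\<close>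

definition pt :: "real \<Rightarrow> real \<Rightarrow> real \<Rightarrow> real \<Rightarrow> 2 phase_space" where
  "pt a b c d = a *\<^sub>R (axis 1 1, 0) + b *\<^sub>R (0, axis 1 1) + c *\<^sub>R (axis 2 1, 0) + d *\<^sub>R (0, axis 2 1)"

lemma pt_sel [simp]:
  "x1 (pt a b c d) = a" "y1 (pt a b c d) = b" "x2 (pt a b c d) = c" "y2 (pt a b c d) = d"
  by (simp_all add: pt_def axis_def)

lemma phase_space_2_eqI: "x1 p = x1 q \<Longrightarrow> y1 p = y1 q \<Longrightarrow> x2 p = x2 q \<Longrightarrow> y2 p = y2 q \<Longrightarrow> p = q"
  by (simp add: prod_eq_iff vec_eq_iff forall_2)

lemma std_symplectic_form_2:
  "std_symplectic_form (u :: 2 phase_space) v =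
    x1 u * y1 v - y1 u * x1 v + (x2 u * y2 v - y2 u * x2 v)"
  by (simp add: std_symplectic_form_def sum_2)

lemma std_symplectic_form_nondegenerate:
  assumes "\<And>v. std_symplectic_form (u :: 2 phase_space) v = 0"
  shows "u = 0"
proof (rule phase_space_2_eqI)
  show "x1 u = x1 0" using assms[of "pt 0 1 0 0"] by (simp add: std_symplectic_form_2)
  show "y1 u = y1 0" using assms[of "pt 1 0 0 0"] by (simp add: std_symplectic_form_2)
  show "x2 u = x2 0" using assms[of "pt 0 0 0 1"] by (simp add: std_symplectic_form_2)
  show "y2 u = y2 0" using assms[of "pt 0 0 1 0"] by (simp add: std_symplectic_form_2)
qed

lemma bounded_linear_coordinate:
  "bounded_linear x1" "bounded_linear y1" "bounded_linear x2" "bounded_linear y2"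
  by (auto intro!: bounded_linear_compose[OF bounded_linear_vec_nth]
      bounded_linear_fst bounded_linear_snd)

lemma smooth_on_pt:
  fixes a b c d :: "'a::real_normed_vector \<Rightarrow> real"
  assumes "open S" "smooth_on S a" "smooth_on S b" "smooth_on S c" "smooth_on S d"
  shows "smooth_on S (\<lambda>x. pt (a x) (b x) (c x) (d x))"
  unfolding pt_def
  by (intro smooth_on_add smooth_on_scaleR smooth_on_const assms)

lemma has_derivative_pt:
  assumes "(a has_derivative a') F" "(b has_derivative b') F"
    "(c has_derivative c') F" "(d has_derivative d') F"
  shows "((\<lambda>x. pt (a x) (b x) (c x) (d x)) has_derivative (\<lambda>v. pt (a' v) (b' v) (c' v) (d' v))) F"
  unfolding pt_def
  by (intro has_derivative_add has_derivative_scaleR_left assms)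

text \<open>The pointwise form of the condition composes by the chain rule and can be verified chart
  by chart.\<close>

definition symplectic_at :: "(2 phase_space \<Rightarrow> 2 phase_space) \<Rightarrow> 2 phase_space \<Rightarrow> bool" where
  "symplectic_at f p \<longleftrightarrow> (\<exists>D. (f has_derivative D) (at p) \<and>
     (\<forall>u v. std_symplectic_form (D u) (D v) = std_symplectic_form u v))"

lemma symplectic_at_compose:
  assumes "symplectic_at f p" "symplectic_at g (f p)"
  shows "symplectic_at (\<lambda>x. g (f x)) p"
proof -
  obtain D E where D: "(f has_derivative D) (at p)"
      "\<And>u v. std_symplectic_form (D u) (D v) = std_symplectic_form u v"
    and E: "(g has_derivative E) (at (f p))"
      "\<And>u v. std_symplectic_form (E u) (E v) = std_symplectic_form u v"
    using assms unfolding symplectic_at_def by blast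
  show ?thesis
    unfolding symplectic_at_def
    using has_derivative_compose[OF D(1) E(1)] D(2) E(2)
    by (intro exI[of _ "\<lambda>v. E (D v)"]) auto
qed

lemma symplectic_at_transform:
  assumes "symplectic_at f p" "open U" "p \<in> U" "\<And>x. x \<in> U \<Longrightarrow> f x = g x"
  shows "symplectic_at g p"
proof -
  obtain D where D: "(f has_derivative D) (at p)"
      "\<And>u v. std_symplectic_form (D u) (D v) = std_symplectic_form u v"
    using assms(1) unfolding symplectic_at_def by blast
  from has_derivative_transform_within_open[OF D(1) assms(2,3,4)] D(2)
  show ?thesis unfolding symplectic_at_def by blast
qed

text \<open>The immersion property comes for free: a kernel vector of the derivative pairs to 0 with
  every vector, hence is 0 by nondegeneracy.\<close>

lemma symplectic_immersionI:
  fixes f :: "2 phase_space \<Rightarrow> 2 phase_space"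
  assumes "f ` S \<subseteq> T" "smooth_on S f" "\<And>p. p \<in> S \<Longrightarrow> symplectic_at f p"
  shows "symplectic_immersion S T f"
proof -
  have form: "std_symplectic_form (frechet_derivative f (at p) u) (frechet_derivative f (at p) v)
      = std_symplectic_form u v" if "p \<in> S" for p u v
    using assms(3)[OF that] frechet_derivative_at[of f _ p] unfolding symplectic_at_def by metis
  have "inj (frechet_derivative f (at p))" if "p \<in> S" for p
  proof -
    have "(f has_derivative frechet_derivative f (at p)) (at p)"
      using assms(3)[OF that] unfolding symplectic_at_def
      by (metis differentiable_def frechet_derivative_works)
    then have lin: "linear (frechet_derivative f (at p))"
      by (rule has_derivative_linear)
    have "u = 0" if "frechet_derivative f (at p) u = 0" for u
    proof (rule std_symplectic_form_nondegenerate)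
      show "std_symplectic_form u v = 0" for v
        using form[OF \<open>p \<in> S\<close>, of u v] that by (simp add: std_symplectic_form_2)
    qed
    then show ?thesis using linear_injective_0[OF lin] by blast
  qed
  then show ?thesis
    unfolding symplectic_immersion_def smooth_immersion_on_def using assms(1,2) form by blast
qed

section \<open>The two building blocks: winding and twisting\<close>

text \<open>Polar coordinates about (-1/4, 0) with angle \<open>a * x1 p\<close>; stretching and
  winding are done at once. The radius is chosen so that \<rho> d\<rho> = -dy1 / a, which makes the
  area element \<rho> d\<rho> \<and> d(a x1) equal to dx1 \<and> dy1.\<close>

definition ribbon :: "real \<Rightarrow> 2 phase_space \<Rightarrow> 2 phase_space" where
  "ribbon a p = (let \<rho> = sqrt (1/4 - 2 * y1 p / a) in
     pt (\<rho> * cos (a * x1 p) - 1/4) (\<rho> * sin (a * x1 p)) (x2 p) (y2 p))"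

text \<open>The time-one map, up to sign convention, of the Hamiltonian x2 H(|z|^2). The flow
  conserves |z|^2 and x2, hence this closed formula.\<close>

definition twist :: "(real \<Rightarrow> real) \<Rightarrow> 2 phase_space \<Rightarrow> 2 phase_space" where
  "twist H p = (let q = (x1 p)\<^sup>2 + (y1 p)\<^sup>2; \<theta> = 2 * x2 p * deriv H q in
     pt (cos \<theta> * x1 p - sin \<theta> * y1 p) (sin \<theta> * x1 p + cos \<theta> * y1 p) (x2 p) (y2 p + H q))"

lemma symplectic_at_ribbon:
  assumes "a > 0" "2 * y1 p / a < 1/4"
  shows "symplectic_at (ribbon a) p"
proof -
  define \<rho> where "\<rho> = sqrt (1/4 - 2 * y1 p / a)"
  define C S where "C = cos (a * x1 p)" and "S = sin (a * x1 p)"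
  have pos: "\<rho> > 0" using assms by (simp add: \<rho>_def)
  define D where "D v = pt (- (\<rho> * S * (a * x1 v)) - (y1 v / (a * \<rho>)) * C)
     (- (y1 v / (a * \<rho>)) * S + \<rho> * C * (a * x1 v)) (x2 v) (y2 v)" for v
  have "((\<lambda>p. (2 / a) * y1 p) has_derivative (\<lambda>v. (2 / a) * y1 v)) (at p)"
    by (rule has_derivative_mult_right[OF
          bounded_linear_imp_has_derivative[OF bounded_linear_coordinate(2)]])
  from has_derivative_diff[OF has_derivative_const this]
  have "((\<lambda>p. 1/4 - 2 * y1 p / a) has_derivative (\<lambda>v. - (2 * y1 v / a))) (at p)"
    by simp
  note arg = this
  have "0 < 1/4 - 2 * y1 p / a" using assms(2) by simp
  from DERIV_compose_FDERIV[OF DERIV_real_sqrt[OF this] arg]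
  have "((\<lambda>p. sqrt (1/4 - 2 * y1 p / a)) has_derivative
      (\<lambda>v. - (2 * y1 v / a) * (inverse \<rho> / 2))) (at p)"
    unfolding \<rho>_def .
  moreover have "(\<lambda>v. - (2 * y1 v / a) * (inverse \<rho> / 2)) = (\<lambda>v. - (y1 v / (a * \<rho>)))"
    by (simp add: field_simps)
  ultimately have \<rho>': "((\<lambda>p. sqrt (1/4 - 2 * y1 p / a)) has_derivative
      (\<lambda>v. - (y1 v / (a * \<rho>)))) (at p)"
    by (simp only:)
  have "((\<lambda>p. a * x1 p) has_derivative (\<lambda>v. a * x1 v)) (at p)"
    by (rule has_derivative_mult_right[OF
          bounded_linear_imp_has_derivative[OF bounded_linear_coordinate(1)]])
  note trig = DERIV_compose_FDERIV[OF DERIV_sin this] DERIV_compose_FDERIV[OF DERIV_cos this]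
  note prod = has_derivative_mult[OF \<rho>' trig(1)] has_derivative_mult[OF \<rho>' trig(2)]
  have "(ribbon a has_derivative D) (at p)"
    unfolding ribbon_def Let_def D_def
    by (rule has_derivative_eq_rhs[OF has_derivative_pt[OF
            has_derivative_diff[OF prod(2) has_derivative_const] prod(1)
            bounded_linear_imp_has_derivative[OF bounded_linear_coordinate(3)]
            bounded_linear_imp_has_derivative[OF bounded_linear_coordinate(4)]]])
      (simp add: \<rho>_def[symmetric] C_def S_def algebra_simps)
  moreover have "std_symplectic_form (D u) (D v) = std_symplectic_form u v" for u v
  proof -
    have CS: "C\<^sup>2 + S\<^sup>2 = 1" by (simp add: C_def S_def)
    \<comment> \<open>The polar area computation on two tangent vectors (r, b) and (r', b'): the
      factors a \<rho> and 1 / (a \<rho>) cancel.\<close>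
    have "(- (\<rho> * S * (a * r)) - (b / (a * \<rho>)) * C) * (- (b' / (a * \<rho>)) * S + \<rho> * C * (a * r'))
      - (- (b / (a * \<rho>)) * S + \<rho> * C * (a * r)) * (- (\<rho> * S * (a * r')) - (b' / (a * \<rho>)) * C)
      = (r * b' - b * r') * (C\<^sup>2 + S\<^sup>2)" for b b' r r'
      using pos assms(1) by (simp add: field_simps power2_eq_square)
    note wedge = this[unfolded CS mult_1_right]
    show ?thesis
      unfolding D_def std_symplectic_form_2 pt_sel wedge by simp
  qed
  ultimately show ?thesis unfolding symplectic_at_def by blast
qed

lemma symplectic_at_twist:
  assumes "smooth_on UNIV H"
  shows "symplectic_at (twist H) p"
proof -
  note [derivative_intros] = bounded_linear_imp_has_derivative[OF bounded_linear_coordinate(1)]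
    bounded_linear_imp_has_derivative[OF bounded_linear_coordinate(2)]
    bounded_linear_imp_has_derivative[OF bounded_linear_coordinate(3)]
    bounded_linear_imp_has_derivative[OF bounded_linear_coordinate(4)]
  define q where "q = (x1 p)\<^sup>2 + (y1 p)\<^sup>2"
  define h h' where "h = deriv H q" and "h' = deriv (deriv H) q"
  define \<theta> where "\<theta> = 2 * x2 p * h"
  define C S where "C = cos \<theta>" and "S = sin \<theta>"
  define dq where "dq v = 2 * (x1 p * x1 v + y1 p * y1 v)" for v
  define d\<theta> where "d\<theta> v = 2 * (x2 v * h + x2 p * (h' * dq v))" for v
  define X Y where "X = x1 p" and "Y = y1 p"
  define D where "D v = pt (C * x1 v - S * y1 v - (S * X + C * Y) * d\<theta> v)
     (S * x1 v + C * y1 v + (C * X - S * Y) * d\<theta> v) (x2 v) (y2 v + h * dq v)" for v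
  have q': "((\<lambda>p. (x1 p)\<^sup>2 + (y1 p)\<^sup>2) has_derivative dq) (at p)"
    unfolding dq_def by (auto intro!: derivative_eq_intros simp: algebra_simps)
  have H: "(H has_real_derivative h) (at ((x1 p)\<^sup>2 + (y1 p)\<^sup>2))"
    "(deriv H has_real_derivative h') (at ((x1 p)\<^sup>2 + (y1 p)\<^sup>2))"
    unfolding h_def h'_def q_def
    by (rule smooth_on_deriv(1)[OF open_UNIV assms UNIV_I]
        smooth_on_deriv(1)[OF open_UNIV smooth_on_deriv(2)[OF open_UNIV assms] UNIV_I])+
  note Hq = DERIV_compose_FDERIV[OF H(1) q'] DERIV_compose_FDERIV[OF H(2) q']
  have \<theta>': "((\<lambda>p. 2 * x2 p * deriv H ((x1 p)\<^sup>2 + (y1 p)\<^sup>2)) has_derivative d\<theta>) (at p)"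
    unfolding d\<theta>_def
    by (auto intro!: derivative_eq_intros Hq simp: h_def q_def algebra_simps)
  note trig = DERIV_compose_FDERIV[OF DERIV_sin \<theta>'] DERIV_compose_FDERIV[OF DERIV_cos \<theta>']
  have "(twist H has_derivative D) (at p)"
    unfolding twist_def Let_def D_def
    by (rule has_derivative_pt)
      (auto intro!: derivative_eq_intros trig Hq
        simp: C_def S_def X_def Y_def \<theta>_def d\<theta>_def h_def q_def algebra_simps)
  moreover have "std_symplectic_form (D u) (D v) = std_symplectic_form u v" for u v
  proof -
    have CS: "C\<^sup>2 + S\<^sup>2 = 1" by (simp add: C_def S_def)
    \<comment> \<open>With q = |z|^2, rotating by a variable angle adds (dq / 2) \<and> d\<theta> to
      the area form. Modulo dq, d\<theta> is 2 h dx2, so the extra term is h dq \<and> dx2; it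
      cancels the term h dx2 \<and> dq produced by the shift of y2.\<close>
    have "(C * r - S * b - (S * X + C * Y) * t) * (S * r' + C * b' + (C * X - S * Y) * t')
      - (S * r + C * b + (C * X - S * Y) * t) * (C * r' - S * b' - (S * X + C * Y) * t')
      = (C\<^sup>2 + S\<^sup>2) * (r * b' - b * r' + (X * r + Y * b) * t' - (X * r' + Y * b') * t)"
      for r b t r' b' t'
      by (simp add: power2_eq_square algebra_simps)
    note wedge = this[unfolded CS mult_1_left]
    show ?thesis
      unfolding D_def std_symplectic_form_2 pt_sel wedge
      by (simp add: d\<theta>_def dq_def X_def Y_def algebra_simps)
  qed
  ultimately show ?thesis unfolding symplectic_at_def by blast
qed

lemma smooth_on_twist_ribbon:
  assumes "smooth_on UNIV H" "open U" "\<And>p. p \<in> U \<Longrightarrow> 2 * y1 p / a < 1/4"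
  shows "smooth_on U (\<lambda>p. twist H (ribbon a p))"
proof -
  have co: "smooth_on U x1" "smooth_on U y1" "smooth_on U x2" "smooth_on U y2"
    by (intro smooth_on_bounded_linear bounded_linear_coordinate)+
  have trig: "smooth_on U (\<lambda>p. sin (f p))" "smooth_on U (\<lambda>p. cos (f p))" if "smooth_on U f"
    for f :: "2 phase_space \<Rightarrow> real"
    by (rule smooth_on_compose_real[OF assms(2) open_UNIV smooth_on_sin_cos(1) that]
        smooth_on_compose_real[OF assms(2) open_UNIV smooth_on_sin_cos(2) that], simp)+
  have sm: "smooth_on U (\<lambda>p. H (f p))" "smooth_on U (\<lambda>p. deriv H (f p))" if "smooth_on U f"
    for f :: "2 phase_space \<Rightarrow> real"
    by (rule smooth_on_compose_real[OF assms(2) open_UNIV assms(1) that]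
        smooth_on_compose_real[OF assms(2) open_UNIV smooth_on_deriv(2)[OF open_UNIV assms(1)] that],
        simp)+
  have lin: "smooth_on U (\<lambda>p. 1/4 - 2 * y1 p / a)"
    unfolding divide_inverse
    by (intro smooth_on_diff smooth_on_mult smooth_on_const co assms(2))
  have \<rho>: "smooth_on U (\<lambda>p. sqrt (1/4 - 2 * y1 p / a))"
    by (rule smooth_on_compose_real[OF assms(2) _ smooth_on_sqrt lin]) (use assms(3) in auto)
  have "smooth_on U (\<lambda>p. a * x1 p)"
    by (rule smooth_on_mult[OF assms(2) smooth_on_const co(1)])
  note t = trig[OF this]
  have PQ: "smooth_on U (\<lambda>p. x1 (ribbon a p))" "smooth_on U (\<lambda>p. y1 (ribbon a p))"
    unfolding ribbon_def Let_def pt_sel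
    by (intro smooth_on_diff smooth_on_mult smooth_on_const t \<rho> assms(2))+
  have XY: "smooth_on U (\<lambda>p. x2 (ribbon a p))" "smooth_on U (\<lambda>p. y2 (ribbon a p))"
    unfolding ribbon_def Let_def pt_sel using co by auto
  have q: "smooth_on U (\<lambda>p. (x1 (ribbon a p))\<^sup>2 + (y1 (ribbon a p))\<^sup>2)"
    by (intro smooth_on_add smooth_on_power PQ assms(2))
  have "smooth_on U (\<lambda>p. 2 * x2 (ribbon a p) * deriv H ((x1 (ribbon a p))\<^sup>2 + (y1 (ribbon a p))\<^sup>2))"
    by (intro smooth_on_mult smooth_on_const XY sm q assms(2))
  note t' = trig[OF this]
  show ?thesis
    unfolding twist_def Let_def
    by (intro smooth_on_pt smooth_on_add smooth_on_diff smooth_on_mult PQ XY t' sm q assms(2))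
qed

section \<open>Wrapping the ball around the annulus\<close>

abbreviation radius2 :: "2 phase_space \<Rightarrow> real" where
  "radius2 p \<equiv> (x1 p)\<^sup>2 + (y1 p)\<^sup>2"

lemma twist_sel [simp]:
  "x2 (twist H p) = x2 p"
  "y2 (twist H p) = y2 p + H (radius2 p)"
  by (simp_all add: twist_def Let_def)

lemma radius2_twist [simp]: "radius2 (twist H p) = radius2 p"
proof -
  have "(C * r - S * b)\<^sup>2 + (S * r + C * b)\<^sup>2 = (C\<^sup>2 + S\<^sup>2) * (r\<^sup>2 + b\<^sup>2)" for C S r b :: real
    by (simp add: power2_eq_square algebra_simps)
  then show ?thesis
    by (simp add: twist_def Let_def)
qed

lemma twist_cong:
  assumes "H (radius2 p) = H' (radius2 p)" "deriv H (radius2 p) = deriv H' (radius2 p)"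
  shows "twist H p = twist H' p"
  using assms by (simp add: twist_def Let_def)

lemma twist_const: "twist (\<lambda>_. c) p = pt (x1 p) (y1 p) (x2 p) (y2 p + c)"
  by (simp add: twist_def Let_def)

lemma rotation_inj:
  fixes r b r' b' \<theta> :: real
  assumes "cos \<theta> * r - sin \<theta> * b = cos \<theta> * r' - sin \<theta> * b'"
    "sin \<theta> * r + cos \<theta> * b = sin \<theta> * r' + cos \<theta> * b'"
  shows "r = r'" "b = b'"
proof -
  have *: "c * (c * u - s * v) + s * (s * u + c * v) = (s\<^sup>2 + c\<^sup>2) * u"
    "c * (s * u + c * v) - s * (c * u - s * v) = (s\<^sup>2 + c\<^sup>2) * v" for c s u v :: real
    by (simp_all add: power2_eq_square algebra_simps)
  show "r = r'"
    using *(1)[of "cos \<theta>" r "sin \<theta>" b] *(1)[of "cos \<theta>" r' "sin \<theta>" b'] assms by simp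
  show "b = b'"
    using *(2)[of "cos \<theta>" "sin \<theta>" r b] *(2)[of "cos \<theta>" "sin \<theta>" r' b'] assms by simp
qed

text \<open>Equal images share |z|^2 and x2, so equal slopes at that radius mean equal rotation
  angles, and the rotation can be undone. The profiles may still differ in value there, which is how
  points on different turns are compared.\<close>

lemma twist_eqD:
  assumes "twist H p = twist H' p'" "deriv H (radius2 p) = deriv H' (radius2 p)"
  shows "x1 p = x1 p'" "y1 p = y1 p'" "x2 p = x2 p'"
    "y2 p + H (radius2 p) = y2 p' + H' (radius2 p)"
proof -
  have q: "radius2 p = radius2 p'"
    using arg_cong[OF assms(1), of radius2] unfolding radius2_twist .
  show x2: "x2 p = x2 p'"
    using arg_cong[OF assms(1), of x2] by simp
  show "y2 p + H (radius2 p) = y2 p' + H' (radius2 p)"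
    using arg_cong[OF assms(1), of y2] q by simp
  define \<theta> where "\<theta> = 2 * x2 p * deriv H (radius2 p)"
  have \<theta>': "\<theta> = 2 * x2 p' * deriv H' (radius2 p')"
    using assms(2) q x2 by (simp add: \<theta>_def)
  have "x1 (twist H p) = cos \<theta> * x1 p - sin \<theta> * y1 p"
    "y1 (twist H p) = sin \<theta> * x1 p + cos \<theta> * y1 p"
    "x1 (twist H' p') = cos \<theta> * x1 p' - sin \<theta> * y1 p'"
    "y1 (twist H' p') = sin \<theta> * x1 p' + cos \<theta> * y1 p'"
    unfolding twist_def Let_def pt_sel \<theta>_def[symmetric] \<theta>'[symmetric] by simp_all
  then show "x1 p = x1 p'" "y1 p = y1 p'"
    using rotation_inj[of \<theta> "x1 p" "y1 p" "x1 p'" "y1 p'"] assms(1) by simp_all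
qed

lemma abs_coordinate_less:
  assumes "p \<in> ball 0 R"
  shows "\<bar>x1 p\<bar> < R" "\<bar>y1 p\<bar> < R" "\<bar>x2 p\<bar> < R" "\<bar>y2 p\<bar> < R"
proof -
  have "\<bar>fst p $ i\<bar> \<le> norm p" "\<bar>snd p $ i\<bar> \<le> norm p" for i
    using component_le_norm_cart[of "fst p" i] component_le_norm_cart[of "snd p" i]
      norm_fst_le[of "fst p" "snd p"] norm_snd_le[of "snd p" "fst p"] by auto
  then show "\<bar>x1 p\<bar> < R" "\<bar>y1 p\<bar> < R" "\<bar>x2 p\<bar> < R" "\<bar>y2 p\<bar> < R"
    using assms by (auto intro: le_less_trans)
qed

lemma mem_cbox_phase_space_2:
  "p \<in> cbox l h \<longleftrightarrow> (x1 l \<le> x1 p \<and> x1 p \<le> x1 h) \<and> (y1 l \<le> y1 p \<and> y1 p \<le> y1 h) \<and>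
     (x2 l \<le> x2 p \<and> x2 p \<le> x2 h) \<and> (y2 l \<le> y2 p \<and> y2 p \<le> y2 h)"
  by (cases p; cases l; cases h) (auto simp: mem_box_cart forall_2)

lemma content_cbox_phase_space_2:
  assumes "x1 l \<le> x1 h" "y1 l \<le> y1 h" "x2 l \<le> x2 h" "y2 l \<le> y2 h"
  shows "measure lborel (cbox l h) =
    ((x1 h - x1 l) * (x2 h - x2 l)) * ((y1 h - y1 l) * (y2 h - y2 l))"
proof -
  have c: "measure lborel (cbox u v) = (v $ 1 - u $ 1) * (v $ 2 - u $ 2)"
    if "u $ 1 \<le> v $ 1" "u $ 2 \<le> v $ 2" for u v :: "real^2"
    using that by (subst content_cbox_cart) (auto simp: interval_ne_empty_cart forall_2 UNIV_2)
  have "measure lborel (cbox l h) = measure lborel (cbox (fst l) (fst h)) * measure lborel (cbox (snd l) (snd h))"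
    using content_Pair[of "fst l" "snd l" "fst h" "snd h"] by simp
  then show ?thesis using assms by (simp add: c)
qed

section \<open>Counting turns\<close>

text \<open>The two roundings agree across each multiple of \<open>2 * pi\<close>, where the sheets are glued.\<close>

definition turns :: "real \<Rightarrow> int" where
  "turns s = (if sin s > 0 then \<lfloor>s / (2 * pi)\<rfloor> else \<lceil>s / (2 * pi)\<rceil>)"

text \<open>Two kinds of charts for the angle: the open half turns of the outward crossing, and the
  closed half turns of the inward crossing enlarged by pi/3 at both ends so as to be open.\<close>

lemma angle_decompose:
  obtains (right) k :: int where "2 * pi * k < s" "s < 2 * pi * k + pi"
  | (left) k :: int where "2 * pi * k - 4 * pi / 3 < s" "s < 2 * pi * k + pi / 3"
proof -
  define k where "k = \<lfloor>s / (2 * pi)\<rfloor>"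
  have "of_int k \<le> s / (2 * pi)" "s / (2 * pi) < of_int k + 1"
    unfolding k_def by linarith+
  then have "2 * pi * k \<le> s" "s < 2 * pi * k + 2 * pi"
    by (simp_all add: field_simps)
  note k = this
  have next_turn: "2 * pi * of_int (k + 1) = 2 * pi * of_int k + 2 * pi"
    by (simp add: algebra_simps)
  consider "s = 2 * pi * k" | "2 * pi * k < s" "s < 2 * pi * k + pi" | "2 * pi * k + pi \<le> s"
    using k(1) by linarith
  then show thesis
  proof cases
    case 1
    then show ?thesis using left[of k] pi_gt_zero by simp
  next
    case 2
    then show ?thesis by (rule right)
  next
    case 3
    \<comment> \<open>The second half of turn k is the inward half that ends at 2 pi (k + 1), hence
      the index k + 1.\<close>
    then have "2 * pi * of_int (k + 1) - 4 * pi / 3 < s" "s < 2 * pi * of_int (k + 1) + pi / 3"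
      using k(2) pi_gt_zero unfolding next_turn by linarith+
    then show ?thesis by (rule left)
  qed
qed

lemma turns_shift: "turns (s + 2 * pi * of_int n) = turns s + n"
proof -
  have "sin (s + 2 * pi * of_int n) = sin s"
    using sin_cos_eq_iff by blast
  moreover have "(s + 2 * pi * of_int n) / (2 * pi) = s / (2 * pi) + of_int n"
    by (simp add: add_divide_distrib)
  ultimately show ?thesis
    by (simp add: turns_def)
qed

lemma cos_gt_half: "\<bar>x\<bar> < pi / 3 \<Longrightarrow> cos x > 1/2"
  using cos_monotone_0_pi[of "\<bar>x\<bar>" "pi / 3"] by (simp add: cos_60)

lemma turns_right:
  assumes "2 * pi * of_int k < s" "s < 2 * pi * of_int k + pi"
  shows "sin s > 0" "turns s = k"
proof -
  define r where "r = s - 2 * pi * of_int k"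
  have s: "s = r + 2 * pi * of_int k" and r: "0 < r" "r < pi"
    using assms by (auto simp: r_def)
  have "sin s = sin r" unfolding s using sin_cos_eq_iff by blast
  then show "sin s > 0" using r sin_gt_zero by simp
  have "turns r = 0"
    using r sin_gt_zero[of r] by (simp add: turns_def floor_eq_iff)
  then show "turns s = k" unfolding s turns_shift by simp
qed

text \<open>On the parts added to the inward half turn, |cos| exceeds 1/2, which will keep the
  ribbon off the annulus. At the lower end the count is one less; there the step \<open>G\<close>
  has reached \<open>2 * R\<close> and makes up for it.\<close>

lemma turns_left:
  assumes "2 * pi * of_int k - 4 * pi / 3 < s" "s < 2 * pi * of_int k + pi / 3"
  shows "sin s \<le> 0 \<and> turns s = k \<or> sin s > 0 \<and> turns s = k \<and> cos s > 1/2 \<or>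
    sin s > 0 \<and> turns s = k - 1 \<and> cos s < -1/2"
proof -
  define r where "r = s - 2 * pi * of_int k"
  have s: "s = r + 2 * pi * of_int k" and r: "- 4 * pi / 3 < r" "r < pi / 3"
    using assms by (auto simp: r_def)
  have sc: "sin s = sin r" "cos s = cos r" unfolding s using sin_cos_eq_iff by blast+
  have t: "turns s = turns r + k" unfolding s turns_shift by simp
  consider "0 < r" | "- pi \<le> r" "r \<le> 0" | "r < - pi" by linarith
  then show ?thesis
  proof cases
    case 1
    then have "sin r > 0" "turns r = 0" "cos r > 1/2"
      using r turns_right[of 0 r] cos_gt_half[of r] by auto
    then show ?thesis using sc t by simp
  next
    case 2
    have "sin r \<le> 0" using sin_ge_zero[of "- r"] 2 by simp
    moreover have "- (pi * 2) < r" using 2(1) pi_gt_zero by linarith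
    with 2(2) \<open>sin r \<le> 0\<close> have "turns r = 0"
      by (simp add: turns_def ceiling_eq_iff field_simps)
    ultimately show ?thesis using sc t by simp
  next
    case 3
    have "sin r > 0" "turns r = -1"
      using 3 r turns_right[of "-1" r] by auto
    moreover have "cos r < -1/2"
      using cos_gt_half[of "r + pi"] 3 r by auto
    ultimately show ?thesis using sc t by simp
  qed
qed

section \<open>Gluing the sheets into a symplectic immersion\<close>

text \<open>The value 5/16 = 1/4 + 1/16 is |z|^2 where the central circle of the ribbon has cos = 0.
  On the ball |2 y1 / a| < \<open>2 * R / a\<close>, so this number bounds the variation of the
  squared ribbon radius; \<open>a \<ge> 200 * R\<close> makes it at most 1/100.\<close>

locale wrapping =
  fixes R a :: real and G :: "real \<Rightarrow> real"
  assumes R: "R > 0" and a: "a \<ge> 200 * R" "a \<ge> 1"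
    and smooth_G: "smooth_on UNIV G"
    and G_low: "\<And>q. q \<le> 5/16 - 2 * R / a \<Longrightarrow> G q = 0"
    and G_high: "\<And>q. q \<ge> 5/16 + 2 * R / a \<Longrightarrow> G q = 2 * R"
begin

definition \<tau> :: real where "\<tau> = 2 * R / a"

text \<open>The profile at angle \<open>s\<close>: the lifts by \<open>2 * R\<close> already
  completed, plus the step in progress during an outward crossing.\<close>

definition sheet :: "real \<Rightarrow> real \<Rightarrow> real" where
  "sheet s q = turns s * (2 * R) + (if sin s > 0 then G q else 0)"

definition wrap :: "2 phase_space \<Rightarrow> 2 phase_space" where
  "wrap p = twist (sheet (a * x1 p)) (ribbon a p)"

lemma a_pos: "a > 0" using a(2) by simp

lemma tau: "0 < \<tau>" "\<tau> \<le> 1/100"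
  using R a a_pos by (auto simp: \<tau>_def field_simps)

lemma deriv_G:
  "(G has_real_derivative deriv G q) (at q)"
  by (rule smooth_on_deriv(1)[OF open_UNIV smooth_G UNIV_I])

lemma deriv_G_low: assumes "q < 5/16 - \<tau>" shows "deriv G q = 0"
proof -
  have "(G has_real_derivative 0) (at q)"
    by (rule has_field_derivative_transform_within_open[of "\<lambda>_. 0" _ _ "{..<5/16 - \<tau>}"])
      (use assms G_low in \<open>auto simp: \<tau>_def\<close>)
  then show ?thesis by (rule DERIV_imp_deriv)
qed

lemma deriv_G_high: assumes "q > 5/16 + \<tau>" shows "deriv G q = 0"
proof -
  have "(G has_real_derivative 0) (at q)"
    by (rule has_field_derivative_transform_within_open[of "\<lambda>_. 2 * R" _ _ "{5/16 + \<tau><..}"])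
      (use assms G_high in \<open>auto simp: \<tau>_def\<close>)
  then show ?thesis by (rule DERIV_imp_deriv)
qed

lemma deriv_sheet: "deriv (sheet s) q = (if sin s > 0 then deriv G q else 0)"
proof -
  have "((\<lambda>q. turns s * (2 * R) + G q) has_real_derivative deriv G q) (at q)"
    using DERIV_add[OF DERIV_const deriv_G] by simp
  then show ?thesis
    unfolding sheet_def by (auto intro: DERIV_imp_deriv)
qed

definition rad :: "2 phase_space \<Rightarrow> real" where
  "rad p = sqrt (1/4 - 2 * y1 p / a)"

lemma ribbon_sel:
  "x1 (ribbon a p) = rad p * cos (a * x1 p) - 1/4" "y1 (ribbon a p) = rad p * sin (a * x1 p)"
  "x2 (ribbon a p) = x2 p" "y2 (ribbon a p) = y2 p"
  by (simp_all add: ribbon_def Let_def rad_def)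

lemma radius2_ribbon:
  "radius2 (ribbon a p) = (rad p)\<^sup>2 + 1/16 - rad p * cos (a * x1 p) / 2"
proof -
  have "(r * c - 1/4)\<^sup>2 + (r * s)\<^sup>2 = r\<^sup>2 * (s\<^sup>2 + c\<^sup>2) + 1/16 - r * c / 2" for r c s :: real
    by (simp add: power2_eq_square algebra_simps)
  then show ?thesis by (simp add: ribbon_sel)
qed

lemma rad_bounds:
  assumes "p \<in> ball 0 R"
  shows "2 * y1 p / a < 1/4" "(rad p)\<^sup>2 = 1/4 - 2 * y1 p / a" "\<bar>(rad p)\<^sup>2 - 1/4\<bar> < \<tau>"
    "12/25 < rad p" "rad p < 13/25"
proof -
  have t: "\<bar>2 * y1 p / a\<bar> < \<tau>"
    using abs_coordinate_less(2)[OF assms] a_pos by (simp add: \<tau>_def abs_mult divide_strict_right_mono)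
  then show l: "2 * y1 p / a < 1/4" using tau by linarith
  then show r: "(rad p)\<^sup>2 = 1/4 - 2 * y1 p / a" unfolding rad_def by simp
  show "\<bar>(rad p)\<^sup>2 - 1/4\<bar> < \<tau>" unfolding r using t by simp
  have "0 \<le> rad p" using l unfolding rad_def by simp
  \<comment> \<open>These fractions satisfy (12/25)^2 < 1/4 - 1/100 and 1/4 + 1/100 <
    (13/25)^2.\<close>
  have "(12/25)\<^sup>2 < (rad p)\<^sup>2" "(rad p)\<^sup>2 < (13/25)\<^sup>2"
    using t tau unfolding r by (auto simp: power2_eq_square abs_if split: if_splits)
  then show "12/25 < rad p" "rad p < 13/25"
    using \<open>0 \<le> rad p\<close> power2_less_imp_less by fastforce+
qed

text \<open>By the law of cosines |z|^2 is below 5/16 + \<tau> - \<open>rad p\<close> / 4, and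
  \<open>rad p\<close> / 4 > 3/25 exceeds 2 \<tau>.\<close>

lemma radius2_ribbon_low:
  assumes "p \<in> ball 0 R" "cos (a * x1 p) > 1/2"
  shows "radius2 (ribbon a p) < 5/16 - \<tau>"
proof -
  have "rad p * (1/2) \<le> rad p * cos (a * x1 p)"
    using rad_bounds[OF assms(1)] assms(2) by (intro mult_left_mono) auto
  then show ?thesis using rad_bounds(3,4)[OF assms(1)] tau unfolding radius2_ribbon by linarith
qed

lemma radius2_ribbon_high:
  assumes "p \<in> ball 0 R" "cos (a * x1 p) < -1/2"
  shows "radius2 (ribbon a p) > 5/16 + \<tau>"
proof -
  have "rad p * cos (a * x1 p) \<le> rad p * (-1/2)"
    using rad_bounds[OF assms(1)] assms(2) by (intro mult_left_mono) auto
  then show ?thesis using rad_bounds(3,4)[OF assms(1)] tau unfolding radius2_ribbon by linarith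
qed

lemma wrap_right:
  assumes "2 * pi * of_int k < a * x1 p" "a * x1 p < 2 * pi * of_int k + pi"
  shows "wrap p = twist (\<lambda>q. of_int k * (2 * R) + G q) (ribbon a p)"
proof -
  have "sheet (a * x1 p) = (\<lambda>q. of_int k * (2 * R) + G q)"
    using turns_right[OF assms] by (simp add: sheet_def fun_eq_iff)
  then show ?thesis by (simp add: wrap_def)
qed

text \<open>No rotation takes place: the profile is flat on the inward half by definition, and on
  the enlargements because the ribbon is off the annulus. At the lower enlargement the heights match
  as (k - 1) 2R + 2R = k 2R.\<close>

lemma wrap_left:
  assumes "p \<in> ball 0 R"
    "2 * pi * of_int k - 4 * pi / 3 < a * x1 p" "a * x1 p < 2 * pi * of_int k + pi / 3"
  shows "wrap p = twist (\<lambda>_. of_int k * (2 * R)) (ribbon a p)"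
  unfolding wrap_def
proof (rule twist_cong)
  show "sheet (a * x1 p) (radius2 (ribbon a p)) = of_int k * (2 * R)"
    using turns_left[OF assms(2,3)] radius2_ribbon_low[OF assms(1)] radius2_ribbon_high[OF assms(1)]
      G_low[folded \<tau>_def] G_high[folded \<tau>_def]
    by (auto simp: sheet_def algebra_simps)
  show "deriv (sheet (a * x1 p)) (radius2 (ribbon a p)) =
      deriv (\<lambda>_. of_int k * (2 * R)) (radius2 (ribbon a p))"
    using turns_left[OF assms(2,3)] radius2_ribbon_low[OF assms(1)] radius2_ribbon_high[OF assms(1)]
      deriv_G_low deriv_G_high
    by (auto simp: deriv_sheet)
qed

text \<open>Although \<open>sheet\<close> jumps with the angle, on each chart it can be replaced by
  one fixed smooth profile, so smoothness and symplecticity follow from those of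
  \<open>twist\<close> and \<open>ribbon\<close>.\<close>

lemma wrap_local:
  assumes "p \<in> ball 0 R"
  obtains U H where "open U" "p \<in> U" "U \<subseteq> ball 0 R" "smooth_on UNIV H"
    "\<And>x. x \<in> U \<Longrightarrow> twist H (ribbon a x) = wrap x"
proof -
  define U where "U l h = ball 0 R \<inter> {x. l < a * x1 x} \<inter> {x. a * x1 x < h}" for l h
  have "open (U l h)" for l h
    unfolding U_def by (intro open_Int open_Collect_less continuous_intros open_ball)
  show thesis
  proof (cases "a * x1 p" rule: angle_decompose)
    case (right k)
    show ?thesis
    proof (rule that[OF \<open>open (U _ _)\<close>])
      show "p \<in> U (2 * pi * k) (2 * pi * k + pi)" "U (2 * pi * k) (2 * pi * k + pi) \<subseteq> ball 0 R"
        using right assms by (auto simp: U_def)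
      show "smooth_on UNIV (\<lambda>q. of_int k * (2 * R) + G q)"
        by (rule smooth_on_add[OF open_UNIV smooth_on_const smooth_G])
      show "twist (\<lambda>q. of_int k * (2 * R) + G q) (ribbon a x) = wrap x"
        if "x \<in> U (2 * pi * k) (2 * pi * k + pi)" for x
        using that wrap_right[of k x] by (simp add: U_def)
    qed
  next
    case (left k)
    let ?U = "U (2 * pi * k - 4 * pi / 3) (2 * pi * k + pi / 3)"
    show ?thesis
    proof (rule that[OF \<open>open (U _ _)\<close>])
      show "p \<in> ?U" "?U \<subseteq> ball 0 R"
        using left assms by (auto simp: U_def)
      show "smooth_on UNIV (\<lambda>_::real. of_int k * (2 * R))"
        by (rule smooth_on_const)
      show "twist (\<lambda>_. of_int k * (2 * R)) (ribbon a x) = wrap x" if "x \<in> ?U" for x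
        using that wrap_left[of x k] by (simp add: U_def)
    qed
  qed
qed

lemma smooth_on_wrap: "smooth_on (ball 0 R) wrap"
proof (rule smooth_on_local)
  fix p assume "p \<in> ball (0 :: 2 phase_space) R"
  then obtain U H where U: "open U" "p \<in> U" "U \<subseteq> ball 0 R" "smooth_on UNIV H"
    "\<And>x. x \<in> U \<Longrightarrow> twist H (ribbon a x) = wrap x"
    by (rule wrap_local) blast
  have "smooth_on U (\<lambda>x. twist H (ribbon a x))"
    by (rule smooth_on_twist_ribbon[OF U(4,1)]) (use U(3) rad_bounds(1) in blast)
  then have "smooth_on U wrap"
    using smooth_on_cong[of U "\<lambda>x. twist H (ribbon a x)" wrap] U(1,5) by simp
  with U(1,2) show "\<exists>U. open U \<and> p \<in> U \<and> smooth_on U wrap"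
    by (intro exI[of _ U] conjI)
qed

lemma symplectic_at_wrap:
  assumes "p \<in> ball 0 R"
  shows "symplectic_at wrap p"
proof -
  obtain U H where U: "open U" "p \<in> U" "U \<subseteq> ball 0 R" "smooth_on UNIV H"
    "\<And>x. x \<in> U \<Longrightarrow> twist H (ribbon a x) = wrap x"
    using assms by (rule wrap_local) blast
  have "symplectic_at (\<lambda>x. twist H (ribbon a x)) p"
    by (rule symplectic_at_compose[OF symplectic_at_ribbon[OF a_pos rad_bounds(1)[OF assms]]
          symplectic_at_twist[OF U(4)]])
  then show ?thesis
    by (rule symplectic_at_transform[OF _ U(1,2,5)])
qed

lemma wrap_in_cylinder:
  assumes "p \<in> ball 0 R"
  shows "wrap p \<in> symplectic_cylinder"
proof -
  have "radius2 (wrap p) = radius2 (ribbon a p)"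
    unfolding wrap_def by (rule radius2_twist)
  \<comment> \<open>The worst case is cos = -1, where |z|^2 = rad^2 + 1/16 + rad / 2, still well
    below 1.\<close>
  moreover have "rad p * (-1) \<le> rad p * cos (a * x1 p)"
    using rad_bounds(4)[OF assms] by (intro mult_left_mono) auto
  ultimately show ?thesis
    using rad_bounds(3,5)[OF assms] tau unfolding radius2_ribbon symplectic_cylinder_def
    by (auto simp: abs_if split: if_splits)
qed

lemma symplectic_immersion_wrap: "symplectic_immersion (ball 0 R) symplectic_cylinder wrap"
  using wrap_in_cylinder smooth_on_wrap symplectic_at_wrap by (intro symplectic_immersionI) auto

section \<open>At most two preimages\<close>

lemma ribbon_eqD:
  assumes "p \<in> ball 0 R" "p' \<in> ball 0 R"
    "x1 (ribbon a p) = x1 (ribbon a p')" "y1 (ribbon a p) = y1 (ribbon a p')"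
  shows "y1 p = y1 p'" "\<exists>n::int. a * x1 p = a * x1 p' + 2 * pi * n"
proof -
  have c: "rad p * cos (a * x1 p) = rad p' * cos (a * x1 p')"
    "rad p * sin (a * x1 p) = rad p' * sin (a * x1 p')"
    using assms(3,4) unfolding ribbon_sel by simp_all
  have sq: "r\<^sup>2 = (r * cos s)\<^sup>2 + (r * sin s)\<^sup>2" for r s :: real
  proof -
    have "(r * cos s)\<^sup>2 + (r * sin s)\<^sup>2 = r\<^sup>2 * ((cos s)\<^sup>2 + (sin s)\<^sup>2)"
      by (simp only: power_mult_distrib distrib_left)
    then show ?thesis by simp
  qed
  have "(rad p)\<^sup>2 = (rad p')\<^sup>2"
    using sq[of "rad p" "a * x1 p"] sq[of "rad p'" "a * x1 p'"] c by simp
  then show "y1 p = y1 p'"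
    unfolding rad_bounds(2)[OF assms(1)] rad_bounds(2)[OF assms(2)] using a_pos by simp
  then have "rad p = rad p'" by (simp add: rad_def)
  moreover have "rad p > 0" using rad_bounds(4)[OF assms(1)] by linarith
  ultimately have "cos (a * x1 p) = cos (a * x1 p')" "sin (a * x1 p) = sin (a * x1 p')"
    using c by auto
  then show "\<exists>n::int. a * x1 p = a * x1 p' + 2 * pi * n"
    using sin_cos_eq_iff by blast
qed

text \<open>On the same kind of half turn the contributions of \<open>G\<close> are equal and
  cancel, so the y2 coordinates differ by an integer multiple of \<open>2 * R\<close>. Both lie
  strictly between -R and R, so the multiple is 0.\<close>

lemma wrap_inj:
  assumes "p \<in> ball 0 R" "p' \<in> ball 0 R" "wrap p = wrap p'"
    "sin (a * x1 p) > 0 \<longleftrightarrow> sin (a * x1 p') > 0"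
  shows "p = p'"
proof -
  let ?q = "radius2 (ribbon a p)"
  have "deriv (sheet (a * x1 p)) ?q = deriv (sheet (a * x1 p')) ?q"
    using assms(4) by (simp add: deriv_sheet)
  note eq = twist_eqD[OF assms(3)[unfolded wrap_def] this]
  have "y2 p + turns (a * x1 p) * (2 * R) = y2 p' + turns (a * x1 p') * (2 * R)"
    using eq(4) assms(4) unfolding ribbon_sel sheet_def by simp
  then have y: "y2 p - y2 p' = (turns (a * x1 p') - turns (a * x1 p)) * (2 * R)"
    by (simp add: algebra_simps)
  have "\<bar>y2 p - y2 p'\<bar> < 2 * R"
    using abs_coordinate_less(4)[OF assms(1)] abs_coordinate_less(4)[OF assms(2)] by linarith
  then have "\<bar>of_int (turns (a * x1 p') - turns (a * x1 p))\<bar> * (2 * R) < 1 * (2 * R)"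
    unfolding y using R by (simp add: abs_mult)
  then have "\<bar>of_int (turns (a * x1 p') - turns (a * x1 p)) :: real\<bar> < 1"
    using R by (simp only: mult_less_cancel_right)
  then have turns: "turns (a * x1 p') = turns (a * x1 p)"
    by linarith
  obtain n :: int where n: "a * x1 p = a * x1 p' + 2 * pi * n"
    using ribbon_eqD(2)[OF assms(1,2) eq(1,2)] by blast
  \<comment> \<open>The ribbon leaves only whole turns undetermined, and equal turn counts exclude
    them.\<close>
  have "n = 0" using turns turns_shift[of "a * x1 p'" n] unfolding n by simp
  show ?thesis
  proof (rule phase_space_2_eqI)
    show "x1 p = x1 p'" using n \<open>n = 0\<close> a_pos by simp
    show "y1 p = y1 p'" by (rule ribbon_eqD(1)[OF assms(1,2) eq(1,2)])
    show "x2 p = x2 p'" using eq(3) unfolding ribbon_sel .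
    show "y2 p = y2 p'" using y turns by simp
  qed
qed

text \<open>The outward crossings; \<open>left\<close> collects the inward ones together with the
  angles where the sine vanishes.\<close>

definition right :: "2 phase_space set" where
  "right = {p \<in> ball 0 R. sin (a * x1 p) > 0}"

definition left :: "2 phase_space set" where
  "left = {p \<in> ball 0 R. sin (a * x1 p) \<le> 0}"

lemma inj_on_wrap: "inj_on wrap right" "inj_on wrap left"
  by (rule inj_onI, rule wrap_inj; simp add: right_def left_def)+

lemma preimage_split: "wrap -` {p} \<inter> ball 0 R = (wrap -` {p} \<inter> right) \<union> (wrap -` {p} \<inter> left)"
  by (auto simp: right_def left_def)

lemma card_le_1_right: "finite (wrap -` {p} \<inter> right) \<and> card (wrap -` {p} \<inter> right) \<le> 1"
  using finite_vimage_IntI[of "{p}" wrap right] card_vimage_inj_on_le[of wrap right "{p}"] inj_on_wrap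
  by simp

lemma card_le_1_left: "finite (wrap -` {p} \<inter> left) \<and> card (wrap -` {p} \<inter> left) \<le> 1"
  using finite_vimage_IntI[of "{p}" wrap left] card_vimage_inj_on_le[of wrap left "{p}"] inj_on_wrap
  by simp

lemma preimages_le_2:
  "finite (wrap -` {p} \<inter> ball 0 R) \<and> card (wrap -` {p} \<inter> ball 0 R) \<le> 2"
  unfolding preimage_split
  using card_le_1_right[of p] card_le_1_left[of p]
    card_Un_le[of "wrap -` {p} \<inter> right" "wrap -` {p} \<inter> left"] by auto

section \<open>Volume of the set of double points\<close>

text \<open>Each half contributes at most one preimage, so two preimages means exactly one from each
  half.\<close>

lemma double_points:
  "{p \<in> symplectic_cylinder. card (wrap -` {p} \<inter> ball 0 R) = 2} = wrap ` right \<inter> wrap ` left"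
proof (intro set_eqI iffI)
  fix p assume "p \<in> {p \<in> symplectic_cylinder. card (wrap -` {p} \<inter> ball 0 R) = 2}"
  then have "card (wrap -` {p} \<inter> ball 0 R) = 2" by simp
  then have "wrap -` {p} \<inter> right \<noteq> {}" "wrap -` {p} \<inter> left \<noteq> {}"
    unfolding preimage_split using card_le_1_right[of p] card_le_1_left[of p] by auto
  then obtain u v where "u \<in> right" "wrap u = p" "v \<in> left" "wrap v = p"
    by auto
  then show "p \<in> wrap ` right \<inter> wrap ` left"
    by (metis IntI imageI)
next
  fix p assume "p \<in> wrap ` right \<inter> wrap ` left"
  then obtain u v where uv: "u \<in> right" "p = wrap u" "v \<in> left" "p = wrap v"
    by (elim IntE imageE)
  then have "u \<noteq> v" by (force simp: right_def left_def)
  have "u \<in> ball 0 R" "v \<in> ball 0 R"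
    using uv(1,3) unfolding right_def left_def by blast+
  then have "{u, v} \<subseteq> wrap -` {p} \<inter> ball 0 R"
    using uv(2,4) by simp
  from card_mono[OF _ this] \<open>u \<noteq> v\<close> preimages_le_2[of p]
  have "card (wrap -` {p} \<inter> ball 0 R) = 2" by auto
  moreover have "p \<in> symplectic_cylinder"
    unfolding uv(2) by (rule wrap_in_cylinder[OF \<open>u \<in> ball 0 R\<close>])
  ultimately show "p \<in> {p \<in> symplectic_cylinder. card (wrap -` {p} \<inter> ball 0 R) = 2}" by simp
qed

text \<open>A differentiable map between spaces of equal dimension sends Lebesgue measurable sets to
  Lebesgue measurable sets.\<close>

lemma double_points_measurable: "wrap ` right \<inter> wrap ` left \<in> sets lebesgue"
proof -
  have op: "open right"
    unfolding right_def Collect_conj_eq Collect_mem_eq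
    by (intro open_Int open_ball open_Collect_less continuous_intros)
  have d: "wrap differentiable_on ball 0 R"
    using smooth_on_wrap unfolding smooth_on_def
    by (intro differentiable_at_imp_differentiable_on) (metis Ck_on.simps(2))
  have l: "left = ball 0 R - right" by (auto simp: left_def right_def)
  have m: "right \<in> sets lebesgue" "left \<in> sets lebesgue"
    unfolding l using op by auto
  have "wrap differentiable_on right" "wrap differentiable_on left"
    by (rule differentiable_on_subset[OF d]; simp add: right_def left_def subset_iff)+
  then have "wrap ` right \<in> sets lebesgue" "wrap ` left \<in> sets lebesgue"
    using m by (simp_all add: differentiable_image_in_sets_lebesgue)
  then show ?thesis by (rule sets.Int)
qed

text \<open>The inward preimage is not rotated, so the first-plane part of p is a ribbon point. It
  must lie in the annulus on an inward crossing, hence near (-1/4, -1/2), where the central circle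
  has cos = 0 and sin = -1.\<close>

lemma double_points_in_box:
  assumes "p \<in> wrap ` right \<inter> wrap ` left"
  shows "\<bar>x1 p + 1/4\<bar> \<le> 4 * \<tau>" "\<bar>y1 p + 1/2\<bar> \<le> 4 * \<tau>" "\<bar>x2 p\<bar> \<le> R"
    "\<bar>y2 p\<bar> \<le> 3 * R + 2 * a * R\<^sup>2"
proof -
  obtain u v where u: "u \<in> ball 0 R" "sin (a * x1 u) > 0" "wrap u = p"
    and v: "v \<in> ball 0 R" "sin (a * x1 v) \<le> 0" "wrap v = p"
    using assms by (auto simp: right_def left_def)
  note b = rad_bounds[OF v(1)]
  let ?s = "a * x1 v"
  have wv: "wrap v = pt (x1 (ribbon a v)) (y1 (ribbon a v)) (x2 v) (y2 v + turns ?s * (2 * R))"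
  proof -
    have "sheet ?s = (\<lambda>_. turns ?s * (2 * R))" using v(2) by (simp add: sheet_def fun_eq_iff)
    then show ?thesis by (simp add: wrap_def twist_const) (simp add: ribbon_def Let_def)
  qed
  have p: "x1 p = rad v * cos ?s - 1/4" "y1 p = rad v * sin ?s" "x2 p = x2 v" "y2 p = y2 v + turns ?s * (2 * R)"
    unfolding v(3)[symmetric] wv pt_sel ribbon_sel by simp_all
  have "radius2 (ribbon a v) = radius2 (ribbon a u)"
    using u(3) v(3) radius2_twist unfolding wrap_def by metis
  then have q: "radius2 (ribbon a u) = (rad v)\<^sup>2 + 1/16 - rad v * cos ?s / 2"
    by (simp add: radius2_ribbon)
  have "5/16 - \<tau> \<le> radius2 (ribbon a u) \<and> radius2 (ribbon a u) \<le> 5/16 + \<tau>"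
  proof (rule ccontr)
    \<comment> \<open>Off the annulus u is not rotated either. Then both ribbon points coincide and
      the angles agree modulo 2 pi, against the opposite signs of the sines.\<close>
    assume out: "\<not> ?thesis"
    then have "deriv G (radius2 (ribbon a u)) = 0"
      using deriv_G_low deriv_G_high by force
    then have "deriv (sheet (a * x1 u)) (radius2 (ribbon a u)) = deriv (sheet ?s) (radius2 (ribbon a u))"
      using v(2) by (simp add: deriv_sheet)
    from twist_eqD(1,2)[OF _ this, of "ribbon a v"] u(3) v(3)
    have "x1 (ribbon a u) = x1 (ribbon a v)" "y1 (ribbon a u) = y1 (ribbon a v)"
      unfolding wrap_def by simp_all
    from ribbon_eqD(2)[OF u(1) v(1) this] have "sin (a * x1 u) = sin ?s"
      using sin_cos_eq_iff by blast
    then show False using u(2) v(2) by simp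
  qed
  \<comment> \<open>Here |z|^2 - 5/16 = (rad^2 - 1/4) - rad cos / 2, and two of these three terms
    are at most \<tau> in size.\<close>
  then have c: "\<bar>rad v * cos ?s\<bar> \<le> 4 * \<tau>"
    using b(3) unfolding q by linarith
  then show "\<bar>x1 p + 1/4\<bar> \<le> 4 * \<tau>" unfolding p by simp
  have "(rad v * cos ?s)\<^sup>2 \<le> (4 * \<tau>)\<^sup>2"
    using c abs_le_square_iff[of "rad v * cos ?s" "4 * \<tau>"] tau by simp
  moreover have "(rad v * sin ?s)\<^sup>2 = (rad v)\<^sup>2 * ((cos ?s)\<^sup>2 + (sin ?s)\<^sup>2) - (rad v * cos ?s)\<^sup>2"
    by (simp only: power_mult_distrib distrib_left)
  ultimately have "(rad v * sin ?s)\<^sup>2 \<le> (rad v)\<^sup>2" "(rad v)\<^sup>2 - (4 * \<tau>)\<^sup>2 \<le> (rad v * sin ?s)\<^sup>2"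
    by auto
  \<comment> \<open>The square of rad sin lies between 1/4 - \<tau> - 16 \<tau>^2 and 1/4 + \<tau>;
    since \<tau> is at most 1/100, the squares of 1/2 - 4 \<tau> and 1/2 + 4 \<tau> enclose that
    range.\<close>
  moreover have "(1/2 + 4 * \<tau>)\<^sup>2 = 1/4 + 4 * \<tau> + 16 * \<tau>\<^sup>2" "(1/2 - 4 * \<tau>)\<^sup>2 = 1/4 - 4 * \<tau> + 16 * \<tau>\<^sup>2"
    by (simp_all add: power2_eq_square algebra_simps)
  moreover have "\<tau>\<^sup>2 \<le> \<tau> / 100" "0 \<le> \<tau>\<^sup>2"
    using tau mult_left_mono[of \<tau> "1/100" \<tau>] by (auto simp: power2_eq_square)
  ultimately have "(1/2 - 4 * \<tau>)\<^sup>2 \<le> (- (rad v * sin ?s))\<^sup>2" "(- (rad v * sin ?s))\<^sup>2 \<le> (1/2 + 4 * \<tau>)\<^sup>2"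
    using b(3) tau unfolding power_mult_distrib[of 4 \<tau>] power2_minus
    by (auto simp: abs_less_iff)
  moreover have "0 \<le> - (rad v * sin ?s)"
    using mult_nonneg_nonpos[of "rad v" "sin ?s"] v(2) b(4) by linarith
  moreover have "0 \<le> 1/2 + 4 * \<tau>" using tau by linarith
  ultimately have "1/2 - 4 * \<tau> \<le> - (rad v * sin ?s)" "- (rad v * sin ?s) \<le> 1/2 + 4 * \<tau>"
    using power2_le_imp_le by blast+
  then show "\<bar>y1 p + 1/2\<bar> \<le> 4 * \<tau>" unfolding p by linarith
  show "\<bar>x2 p\<bar> \<le> R" unfolding p using abs_coordinate_less(3)[OF v(1)] by simp
  \<comment> \<open>The ball meets at most about a R turns in either direction; each lifts by
    \<open>2 * R\<close>, and the original y2 adds less than R.\<close>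
  have "\<bar>?s\<bar> \<le> a * R"
    using abs_coordinate_less(1)[OF v(1)] a_pos by (simp add: abs_mult)
  moreover have "\<bar>?s / (2 * pi)\<bar> \<le> \<bar>?s\<bar>"
    using divide_left_mono[of 1 "2 * pi" "\<bar>?s\<bar>"] pi_ge_two by simp
  moreover have "\<bar>of_int \<lceil>x\<rceil>\<bar> \<le> \<bar>x\<bar> + 1" for x :: real
    by linarith
  from this[of "?s / (2 * pi)"] have "\<bar>of_int (turns ?s)\<bar> \<le> \<bar>?s / (2 * pi)\<bar> + 1"
    unfolding turns_def using v(2) by simp
  ultimately have "\<bar>of_int (turns ?s)\<bar> \<le> a * R + 1"
    by linarith
  then have "\<bar>of_int (turns ?s)\<bar> * (2 * R) \<le> (a * R + 1) * (2 * R)"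
    using R by (intro mult_right_mono) auto
  then have "\<bar>turns ?s * (2 * R)\<bar> \<le> 2 * a * R\<^sup>2 + 2 * R"
    using R by (simp add: abs_mult power2_eq_square algebra_simps)
  then show "\<bar>y2 p\<bar> \<le> 3 * R + 2 * a * R\<^sup>2"
    unfolding p using abs_coordinate_less(4)[OF v(1)] by linarith
qed

lemma emeasure_double_points:
  "emeasure lebesgue (wrap ` right \<inter> wrap ` left) \<le> ennreal (1024 * R ^ 4 * (3 + 2 * R) / a)"
proof -
  define M where "M = 3 * R + 2 * a * R\<^sup>2"
  define l h where "l = pt (-1/4 - 4 * \<tau>) (-1/2 - 4 * \<tau>) (- R) (- M)"
    and "h = pt (-1/4 + 4 * \<tau>) (-1/2 + 4 * \<tau>) R M"
  have M: "M > 0" using R a_pos by (simp add: M_def add_pos_pos)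
  have "wrap ` right \<inter> wrap ` left \<subseteq> cbox l h"
  proof
    fix p assume "p \<in> wrap ` right \<inter> wrap ` left"
    from double_points_in_box[OF this, folded M_def] show "p \<in> cbox l h"
      unfolding mem_cbox_phase_space_2 l_def h_def pt_sel by linarith
  qed
  then have "emeasure lebesgue (wrap ` right \<inter> wrap ` left) \<le> emeasure lebesgue (cbox l h)"
    by (rule emeasure_mono) simp
  also have "\<dots> = ennreal (measure lborel (cbox l h))"
    using emeasure_lborel_cbox_finite[of l h]
    by (simp add: emeasure_eq_ennreal_measure less_top)
  \<comment> \<open>Two sides of length 8 \<tau> give a factor of order 1 / a^2, while the y2 side
    grows only like a.\<close>
  also have "measure lborel (cbox l h) = (8 * \<tau> * (2 * R)) * (8 * \<tau> * (2 * M))"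
    using tau R M by (subst content_cbox_phase_space_2) (simp_all add: l_def h_def)
  also have "\<dots> = 1024 * R ^ 4 * (3 + 2 * a * R) / a\<^sup>2"
    using a_pos by (simp add: \<tau>_def M_def field_simps power2_eq_square power4_eq_xxxx)
  also have "\<dots> \<le> 1024 * R ^ 4 * (3 + 2 * R) / a"
  proof -
    have "3 + 2 * a * R \<le> a * (3 + 2 * R)"
      using a(2) by (simp add: algebra_simps)
    then have "1024 * R ^ 4 * (3 + 2 * a * R) / a\<^sup>2 \<le> 1024 * R ^ 4 * (a * (3 + 2 * R)) / a\<^sup>2"
      by (intro divide_right_mono mult_left_mono) auto
    also have "\<dots> = 1024 * R ^ 4 * (3 + 2 * R) / a"
      using a_pos by (simp add: power2_eq_square)
    finally show ?thesis .
  qed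
  finally show ?thesis
    by (simp add: ennreal_leI)
qed

end

theorem corollary1:
  fixes R \<epsilon> :: real
  assumes "R > 0" and "\<epsilon> > 0"
  shows "\<exists>f :: 2 phase_space \<Rightarrow> 2 phase_space.
           symplectic_immersion (ball 0 R) symplectic_cylinder f \<and>
           (\<forall>p \<in> symplectic_cylinder.
              finite (f -` {p} \<inter> ball 0 R) \<and> card (f -` {p} \<inter> ball 0 R) \<le> 2) \<and>
           {p \<in> symplectic_cylinder. card (f -` {p} \<inter> ball 0 R) = 2} \<in> sets lebesgue \<and>
           emeasure lebesgue {p \<in> symplectic_cylinder. card (f -` {p} \<inter> ball 0 R) = 2}
             \<le> ennreal \<epsilon>"
proof -
  \<comment> \<open>The entries of the maximum give, in order, \<open>a \<ge> 1\<close>, \<tau> at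
    most 1/100, and the volume bound at most \<epsilon>.\<close>
  define a where "a = max (max 1 (200 * R)) (1024 * R ^ 4 * (3 + 2 * R) / \<epsilon>)"
  have ge: "a \<ge> 1" "a \<ge> 200 * R" "a \<ge> 1024 * R ^ 4 * (3 + 2 * R) / \<epsilon>"
    by (auto simp: a_def)
  have "5/16 - 2 * R / a < 5/16 + 2 * R / a"
    using assms(1) ge(1) by simp
  then obtain G where "smooth_on UNIV G" "\<And>q. q \<le> 5/16 - 2 * R / a \<Longrightarrow> G q = 0"
      "\<And>q. q \<ge> 5/16 + 2 * R / a \<Longrightarrow> G q = 2 * R"
    using smooth_step[of "5/16 - 2 * R / a" "5/16 + 2 * R / a" "2 * R"] by metis
  with assms(1) ge interpret wrapping R a G
    by unfold_locales
  have "1024 * R ^ 4 * (3 + 2 * R) / a \<le> \<epsilon>"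
    using ge(3) assms(2) a_pos by (simp add: field_simps)
  then have "emeasure lebesgue (wrap ` right \<inter> wrap ` left) \<le> ennreal \<epsilon>"
    using emeasure_double_points by (meson ennreal_leI order_trans)
  with symplectic_immersion_wrap preimages_le_2 double_points_measurable show ?thesis
    by (intro exI[of _ wrap]) (simp only: double_points, blast)
qed

end
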